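(* Let $w=\log_2 3$. Then, as $n\to\infty$, $a(n) = 2^{n}\left(1-\mathcal{O}\left(\frac{1}{n^w}\right)\right)$ and $b(n) = n\left(1-\mathcal{O}\left(\frac{1}{(\log n)^w}\right)\right)$.
   Context: $\mu$ is the morphism on binary words defined by $\mu(0)=01$, $\mu(1)=10$, with $n$-fold iterate $\mu^n$. $a(n)$ is the length of a longest common subsequence of $\mu^n(0)$ and $\mu^n(1)$. The Thue–Morse sequence $\mathbf{t}=t_0t_1\cdots$ is the fixed point of $\mu$ starting with $0$ (equivalently $t_i$ is the parity of the number of $1$'s in the binary expansion of $i$), and $b(n)$ is the length of a longest common subsequence of the length-$n$ prefix of $\mathbf{t}$ and its bitwise complement. *)

theory Defs
  imports Complex_Main "HOL-Library.Sublist" "HOL-Library.Landau_Symbols"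
begin

text \<open>Binary words are lists of Booleans, with \<^const>\<open>False\<close> for the letter 0 and
  \<^const>\<open>True\<close> for the letter 1.\<close>

type_synonym binword = "bool list"

definition mu :: "binword \<Rightarrow> binword" where
  "mu u = concat (map (\<lambda>c. if c then [True, False] else [False, True]) u)"

text \<open>\<^const>\<open>subseq\<close> is the scattered (not necessarily contiguous) subsequence relation.\<close>

definition lcs_length :: "'a list \<Rightarrow> 'a list \<Rightarrow> nat" where
  "lcs_length u v = Max {length z | z. subseq z u \<and> subseq z v}"

definition a_seq :: "nat \<Rightarrow> nat" where
  "a_seq n = lcs_length ((mu ^^ n) [False]) ((mu ^^ n) [True])"

definition pref :: "(nat \<Rightarrow> 'a) \<Rightarrow> nat \<Rightarrow> 'a list" where
  "pref s n = map s [0..<n]"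

text \<open>Since \<^const>\<open>mu\<close> doubles lengths, an infinite word is fixed by the extension of
  \<^const>\<open>mu\<close> to infinite words iff \<^const>\<open>mu\<close> maps its prefix of length n to its
  prefix of length 2n, for every n.\<close>

definition mu_fixed :: "(nat \<Rightarrow> bool) \<Rightarrow> bool" where
  "mu_fixed s \<longleftrightarrow> (\<forall>n. mu (pref s n) = pref s (2 * n))"

definition thue_morse :: "nat \<Rightarrow> bool" where
  "thue_morse = (THE s. mu_fixed s \<and> s 0 = False)"

definition b_seq :: "nat \<Rightarrow> nat" where
  "b_seq n = lcs_length (pref thue_morse n) (map Not (pref thue_morse n))"

lemma lcs_length_set:
  "finite {length z | z. subseq z u \<and> subseq z v}"
  "{length z | z. subseq z u \<and> subseq z v} \<noteq> {}"
proof -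
  have "{length z | z. subseq z u \<and> subseq z v} \<subseteq> {..length u}"
    by (auto dest: list_emb_length)
  then show "finite {length z | z. subseq z u \<and> subseq z v}"
    by (rule finite_subset) simp
  have "subseq [] u \<and> subseq [] v" by simp
  then show "{length z | z. subseq z u \<and> subseq z v} \<noteq> {}" by blast
qed

lemma mu_fixed_iff:
  "mu_fixed s \<longleftrightarrow> (\<forall>i. s (2 * i) = s i \<and> s (2 * i + 1) = (\<not> s i))"
proof
  assume fx: "mu_fixed s"
  show "\<forall>i. s (2 * i) = s i \<and> s (2 * i + 1) = (\<not> s i)"
  proof
    fix i
    have p: "mu (pref s i) = pref s (2 * i)" "mu (pref s (Suc i)) = pref s (2 * Suc i)"
      using fx by (auto simp: mu_fixed_def)
    have "mu (pref s (Suc i)) = mu (pref s i) @ mu [s i]"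
      by (simp add: mu_def pref_def)
    moreover have "pref s (2 * Suc i) = pref s (2 * i) @ [s (2 * i), s (2 * i + 1)]"
      by (simp add: pref_def)
    ultimately have "mu [s i] = [s (2 * i), s (2 * i + 1)]"
      using p by simp
    then show "s (2 * i) = s i \<and> s (2 * i + 1) = (\<not> s i)"
      by (auto simp: mu_def split: if_splits)
  qed
next
  assume s: "\<forall>i. s (2 * i) = s i \<and> s (2 * i + 1) = (\<not> s i)"
  have "mu (pref s n) = pref s (2 * n)" for n
  proof (induction n)
    case 0
    show ?case by (simp add: mu_def pref_def)
  next
    case (Suc n)
    have "mu (pref s (Suc n)) = mu (pref s n) @ mu [s n]"
      by (simp add: mu_def pref_def)
    also have "\<dots> = pref s (2 * n) @ [s (2 * n), s (2 * n + 1)]"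
      using Suc s[rule_format, of n] by (simp add: mu_def)
    also have "\<dots> = pref s (2 * Suc n)"
      by (simp add: pref_def)
    finally show ?case .
  qed
  then show "mu_fixed s" by (simp add: mu_fixed_def)
qed

lemma finite_bits_nat: "finite {k. bit (i::nat) k}"
proof -
  have "{k. bit i k} \<subseteq> {..<i}"
  proof
    fix k assume "k \<in> {k. bit i k}"
    then have "i div 2 ^ k \<noteq> 0" by (auto simp: bit_iff_odd intro: ccontr)
    then have "2 ^ k \<le> i" by (simp add: div_eq_0_iff)
    moreover have "k < 2 ^ k" by (rule less_exp)
    ultimately have "k < i" by (rule less_le_trans[rotated])
    then show "k \<in> {..<i}" by simp
  qed
  then show ?thesis by (rule finite_subset) simp
qed

lemma card_bits_double:
  "card {k. bit (2 * i) k} = card {k. bit (i::nat) k}"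
  "card {k. bit (2 * i + 1) k} = Suc (card {k. bit (i::nat) k})"
proof -
  have e: "{k. bit (2 * i) k} = Suc ` {k. bit i k}"
  proof (intro set_eqI)
    fix k show "k \<in> {k. bit (2 * i) k} \<longleftrightarrow> k \<in> Suc ` {k. bit i k}"
      by (cases k) (auto simp: bit_0 bit_Suc)
  qed
  have o: "{k. bit (2 * i + 1) k} = insert 0 (Suc ` {k. bit i k})"
  proof (intro set_eqI)
    fix k show "k \<in> {k. bit (2 * i + 1) k} \<longleftrightarrow> k \<in> insert 0 (Suc ` {k. bit i k})"
      by (cases k) (auto simp: bit_0 bit_Suc)
  qed
  show "card {k. bit (2 * i) k} = card {k. bit i k}"
    unfolding e by (simp add: card_image)
  show "card {k. bit (2 * i + 1) k} = Suc (card {k. bit i k})"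
    unfolding o by (simp add: card_image finite_bits_nat)
qed

lemma card_bits_0: "card {k. bit (0::nat) k} = 0"
proof -
  have "{k. bit (0::nat) k} = {}" by auto
  then show ?thesis by (simp only: card.empty)
qed

lemma thue_morse_eq_parity: "thue_morse = (\<lambda>i. odd (card {k. bit i k}))"
  unfolding thue_morse_def
proof (rule the_equality)
  show "mu_fixed (\<lambda>i. odd (card {k. bit i k})) \<and> odd (card {k. bit (0::nat) k}) = False"
    unfolding mu_fixed_iff by (simp only: card_bits_double card_bits_0) simp
next
  fix s :: "nat \<Rightarrow> bool"
  assume s: "mu_fixed s \<and> s 0 = False"
  have "s i = odd (card {k. bit i k})" for i
  proof (induction i rule: less_induct)
    case (less i)
    show ?case
    proof (cases "i = 0")
      case True
      then show ?thesis using s card_bits_0 by (simp only:) simp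
    next
      case False
      define j where "j = i div 2"
      have IH: "s j = odd (card {k. bit j k})" using less False by (simp add: j_def)
      have rec: "s (2 * j) = s j" "s (2 * j + 1) = (\<not> s j)"
        using s mu_fixed_iff by blast+
      have "i = 2 * j \<or> i = 2 * j + 1" unfolding j_def by linarith
      then show ?thesis
        using IH rec card_bits_double[of j] by auto
    qed
  qed
  then show "s = (\<lambda>i. odd (card {k. bit i k}))" by blast
qed

lemma mu_fixed_thue_morse: "mu_fixed thue_morse" and thue_morse_0: "\<not> thue_morse 0"
  unfolding mu_fixed_iff thue_morse_eq_parity by (simp_all only: card_bits_double card_bits_0) simp_all

end

theory Submission
  imports Defs
begin

text \<open>Write \<open>f n = 1 - a(n) / 2^n\<close>. Cut \<open>\<mu>\<^sup>m\<^sup>+\<^sup>k(0)\<close> and \<open>\<mu>\<^sup>m\<^sup>+\<^sup>k(1)\<close> into \<open>2^k\<close> blocks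
  \<open>\<mu>\<^sup>m(0)\<close>, \<open>\<mu>\<^sup>m(1)\<close> and align them with a shift of one block. Block \<open>i\<close> of the first word then
  faces an equal block iff \<open>t\<^sub>i \<noteq> t\<^sub>i\<^sub>+\<^sub>1\<close>, which fails for at most a third of the indices; an
  unequal pair still has a common subsequence of length \<open>a(m)\<close>. Hence
  \<open>f (m + k) \<le> 2^-k + f m / 3\<close>, and taking \<open>k = n div 4\<close>, \<open>m = n - k\<close> this gives
  \<open>f n = O(1 / n^2)\<close>, which is stronger than the claim as \<open>log 2 3 < 2\<close>. For \<open>b(n)\<close>, cut the prefix
  into blocks of length about \<open>sqrt n\<close> and match them without shift.\<close>

section \<open>Longest common subsequences\<close>

lemma lcs_length_ge: "subseq z u \<Longrightarrow> subseq z v \<Longrightarrow> length z \<le> lcs_length u v"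
  unfolding lcs_length_def by (rule Max_ge[OF lcs_length_set(1)]) blast

lemma lcs_length_witness:
  obtains z where "subseq z u" "subseq z v" "length z = lcs_length u v"
proof -
  have "lcs_length u v \<in> {length z | z. subseq z u \<and> subseq z v}"
    unfolding lcs_length_def by (rule Max_in[OF lcs_length_set])
  then show ?thesis using that by auto
qed

lemma lcs_length_le: "lcs_length u v \<le> length u"
  by (metis lcs_length_witness list_emb_length)

lemma lcs_length_self: "lcs_length u u = length u"
  using lcs_length_ge[of u u u] lcs_length_le[of u u] by simp

lemma lcs_length_commute: "lcs_length u v = lcs_length v u"
  unfolding lcs_length_def by (simp add: conj_commute)

lemma lcs_length_append:
  "lcs_length u v + lcs_length u' v' \<le> lcs_length (u @ u') (v @ v')"
proof -
  obtain z where z: "subseq z u" "subseq z v" "length z = lcs_length u v"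
    by (rule lcs_length_witness)
  obtain z' where z': "subseq z' u'" "subseq z' v'" "length z' = lcs_length u' v'"
    by (rule lcs_length_witness)
  show ?thesis
    using lcs_length_ge[of "z @ z'" "u @ u'" "v @ v'"] z z' by (simp add: list_emb_append_mono)
qed

lemma lcs_length_mono:
  assumes "subseq u u'" "subseq v v'"
  shows "lcs_length u v \<le> lcs_length u' v'"
proof -
  obtain z where z: "subseq z u" "subseq z v" "length z = lcs_length u v"
    by (rule lcs_length_witness)
  then show ?thesis
    using assms by (metis lcs_length_ge subseq_order.order_trans)
qed

text \<open>Common subsequences of matched blocks concatenate, so every blockwise alignment of two
  words yields a lower bound.\<close>

lemma lcs_length_concat:
  "(\<Sum>i<q. lcs_length (f i) (g i)) \<le>
    lcs_length (concat (map f [0..<q])) (concat (map g [0..<q]))"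
proof (induction q)
  case (Suc q)
  show ?case
    using Suc.IH lcs_length_append[of "concat (map f [0..<q])" "concat (map g [0..<q])" "f q" "g q"]
    by simp
qed simp

section \<open>Block structure of the Thue--Morse sequence\<close>

lemma thue_morse_double:
  "thue_morse (2 * i) = thue_morse i" "thue_morse (Suc (2 * i)) = (\<not> thue_morse i)"
  using mu_fixed_thue_morse unfolding mu_fixed_iff by auto

lemma mu_append: "mu (u @ v) = mu u @ mu v"
  by (simp add: mu_def)

lemma mu_pow_append: "(mu ^^ m) (u @ v) = (mu ^^ m) u @ (mu ^^ m) v"
  by (induction m) (simp_all add: mu_append)

lemma mu_pow_Nil: "(mu ^^ m) [] = []"
  by (induction m) (simp_all add: mu_def)

lemma length_mu: "length (mu u) = 2 * length u"
  by (induction u) (simp_all add: mu_def)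

lemma length_mu_pow: "length ((mu ^^ m) u) = 2 ^ m * length u"
  by (induction m) (simp_all add: length_mu)

lemma mu_map_Not: "mu (map Not u) = map Not (mu u)"
  by (induction u) (simp_all add: mu_def)

lemma mu_pow_map_Not: "(mu ^^ m) (map Not u) = map Not ((mu ^^ m) u)"
  by (induction m) (simp_all add: mu_map_Not)

lemma mu_pow_pref_thue_morse: "(mu ^^ m) (pref thue_morse q) = pref thue_morse (q * 2 ^ m)"
proof (induction m)
  case (Suc m)
  then show ?case
    using mu_fixed_thue_morse by (simp add: mu_fixed_def mult.left_commute)
qed simp

lemma mu_pow_pref: "(mu ^^ m) (pref s q) = concat (map (\<lambda>i. (mu ^^ m) [s i]) [0..<q])"
  by (induction q) (simp_all add: pref_def mu_pow_append mu_pow_Nil)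

text \<open>\<open>thue_morse\<close> is fixed by \<open>mu ^^ m\<close>, and complementing letters
  commutes with \<open>mu\<close>.\<close>

lemma thue_morse_blocks:
  "pref thue_morse (q * 2 ^ m) = concat (map (\<lambda>i. (mu ^^ m) [thue_morse i]) [0..<q])"
  "map Not (pref thue_morse (q * 2 ^ m)) = concat (map (\<lambda>i. (mu ^^ m) [\<not> thue_morse i]) [0..<q])"
proof -
  show "pref thue_morse (q * 2 ^ m) = concat (map (\<lambda>i. (mu ^^ m) [thue_morse i]) [0..<q])"
    by (simp flip: mu_pow_pref mu_pow_pref_thue_morse)
  have "map Not (pref thue_morse (q * 2 ^ m)) = (mu ^^ m) (pref (\<lambda>i. \<not> thue_morse i) q)"
    unfolding mu_pow_pref_thue_morse[symmetric] mu_pow_map_Not[symmetric]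
    by (simp add: pref_def comp_def)
  then show "map Not (pref thue_morse (q * 2 ^ m)) = concat (map (\<lambda>i. (mu ^^ m) [\<not> thue_morse i]) [0..<q])"
    by (simp add: mu_pow_pref)
qed

text \<open>The case of a single block, \<open>q = 1\<close>, where \<open>thue_morse 0\<close> is
  the letter 0.\<close>

lemma a_seq_eq:
  "a_seq n = lcs_length (pref thue_morse (2 ^ n)) (map Not (pref thue_morse (2 ^ n)))"
  using thue_morse_blocks[of 1 n] thue_morse_0 by (simp add: a_seq_def)

lemma a_seq_le: "a_seq n \<le> 2 ^ n"
  using lcs_length_le[of "(mu ^^ n) [False]"] by (simp add: a_seq_def length_mu_pow)

lemma lcs_length_blocks:
  "lcs_length ((mu ^^ m) [c]) ((mu ^^ m) [d]) = (if c = d then 2 ^ m else a_seq m)"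
  by (cases c; cases d) (auto simp: a_seq_def lcs_length_self length_mu_pow lcs_length_commute)

section \<open>The recursive bound\<close>

text \<open>After the shift, the block of \<open>thue_morse i\<close> faces that of
  \<open>\<not> thue_morse (Suc i)\<close>, so repeats are exactly the unequal pairs.\<close>

definition repeats :: "nat \<Rightarrow> nat" where
  "repeats q = (\<Sum>i<q. of_bool (thue_morse i = thue_morse (Suc i)))"

text \<open>An even position is never a repeat, and \<open>2j + 1\<close> is one iff \<open>j\<close> is not.\<close>

lemma repeats_double: "repeats (2 * q + 1) + repeats q = q"
proof (induction q)
  case 0
  show ?case
    using thue_morse_double[of 0] by (simp add: repeats_def)
next
  case (Suc q)
  then show ?case
    using thue_morse_double[of q] thue_morse_double[of "Suc q"] by (simp add: repeats_def)
qed

text \<open>One use of \<open>repeats_double\<close> turns an upper bound into a lower one. Two uses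
  give \<open>repeats (4 * q + 3) = q + 1 + repeats q\<close>, which preserves the bound; hence the
  induction in steps of two.\<close>

lemma repeats_le: "3 * repeats (2 ^ k - 1) \<le> 2 ^ k - 1"
proof (induction k rule: induct_nat_012)
  case 1
  show ?case using repeats_double[of 0] by simp
next
  case (ge2 k)
  define q where "q = (2::nat) ^ k - 1"
  have "2 ^ k = q + 1" by (simp add: q_def)
  then have eq: "2 ^ Suc (Suc k) - 1 = 2 * (2 * q + 1) + 1" by simp
  have "repeats (2 * (2 * q + 1) + 1) = q + 1 + repeats q"
    using repeats_double[of q] repeats_double[of "2 * q + 1"] by presburger
  then show ?case
    unfolding eq using ge2(1)[folded q_def] by simp
qed (simp add: repeats_def)

text \<open>The shift discards the last block of one word and the first of the other, at a cost of
  \<open>2 ^ m\<close>. Among the remaining \<open>2 ^ k - 1\<close> pairs, each repeat costs at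
  most \<open>2 ^ m - a_seq m\<close>.\<close>

lemma a_seq_shift:
  "real (2 ^ (m + k)) - a_seq (m + k) \<le> 2 ^ m + repeats (2 ^ k - 1) * (2 ^ m - real (a_seq m))"
proof -
  define p where "p = (2::nat) ^ k - 1"
  have p: "2 ^ (m + k) = Suc p * 2 ^ m" "2 ^ k = Suc p" by (simp_all add: p_def power_add)
  define B where "B c = (mu ^^ m) [c]" for c
  define X where "X = concat (map (\<lambda>i. B (thue_morse i)) [0..<p])"
  define Y where "Y = concat (map (\<lambda>i. B (\<not> thue_morse (Suc i))) [0..<p])"
  have "pref thue_morse (2 ^ (m + k)) = X @ B (thue_morse p)"
    unfolding p thue_morse_blocks by (simp add: X_def B_def)
  moreover have "map Not (pref thue_morse (2 ^ (m + k))) = B (\<not> thue_morse 0) @ Y"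
    unfolding p thue_morse_blocks(2)
    by (simp add: Y_def B_def upt_conv_Cons map_Suc_upt[symmetric] comp_def del: upt_Suc map_Suc_upt)
  ultimately have "lcs_length X Y \<le> a_seq (m + k)"
    unfolding a_seq_eq by (simp only: lcs_length_mono list_emb_prefix list_emb_append2 subseq_order.order_refl)
  moreover have "(\<Sum>i<p. if thue_morse i = (\<not> thue_morse (Suc i)) then 2 ^ m else a_seq m) \<le> lcs_length X Y"
    using lcs_length_concat[of "\<lambda>i. B (thue_morse i)" "\<lambda>i. B (\<not> thue_morse (Suc i))" p]
    by (simp only: X_def Y_def B_def lcs_length_blocks)
  ultimately have "real (\<Sum>i<p. if thue_morse i = (\<not> thue_morse (Suc i)) then 2 ^ m else a_seq m) \<le> a_seq (m + k)"
    by (simp only: of_nat_le_iff order_trans)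
  moreover have "real (\<Sum>i<p. if thue_morse i = (\<not> thue_morse (Suc i)) then 2 ^ m else a_seq m)
      = p * 2 ^ m - repeats p * (2 ^ m - real (a_seq m))"
    unfolding repeats_def
    by (induction p) (auto simp: algebra_simps)
  ultimately show ?thesis
    unfolding p_def[symmetric] p by (simp add: algebra_simps)
qed

text \<open>This is \<open>f\<close>, the loss relative to the word length.\<close>

definition deficit :: "nat \<Rightarrow> real" where
  "deficit n = 1 - a_seq n / 2 ^ n"

lemma deficit_nonneg: "0 \<le> deficit n"
  using of_nat_mono[OF a_seq_le, of n, where 'a = real] by (simp add: deficit_def)

lemma deficit_le_1: "deficit n \<le> 1"
  by (simp add: deficit_def)

lemma deficit_rec: "deficit (m + k) \<le> 1 / 2 ^ k + deficit m / 3"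
proof -
  have "3 * repeats (2 ^ k - 1) \<le> 2 ^ k"
    using repeats_le[of k] by linarith
  then have "3 * real (repeats (2 ^ k - 1)) \<le> 2 ^ k"
    by (metis of_nat_le_iff of_nat_mult of_nat_numeral of_nat_power)
  then have r: "real (repeats (2 ^ k - 1)) \<le> 2 ^ k / 3" by simp
  have d: "deficit n * 2 ^ n = 2 ^ n - real (a_seq n)" for n
    by (simp add: deficit_def field_simps)
  have "deficit (m + k) * 2 ^ (m + k) \<le> 2 ^ m + repeats (2 ^ k - 1) * (deficit m * 2 ^ m)"
    unfolding d using a_seq_shift[of m k] by simp
  also have "\<dots> \<le> 2 ^ m + 2 ^ k / 3 * (deficit m * 2 ^ m)"
    using r deficit_nonneg[of m] by (intro add_left_mono mult_right_mono) auto
  also have "\<dots> = (1 / 2 ^ k + deficit m / 3) * 2 ^ (m + k)"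
    by (simp add: power_add field_simps)
  finally show ?thesis by simp
qed

lemma square_le_pow2: "real j ^ 2 \<le> 2 * 2 ^ j"
proof (induction j rule: less_induct)
  case (less j)
  show ?case
  proof (cases "j < 3")
    case True
    then have "j = 0 \<or> j = 1 \<or> j = 2" by auto
    then show ?thesis by auto
  next
    case False
    then obtain i where j: "j = Suc i" and i: "2 \<le> i" by (cases j) auto
    show ?thesis
    proof (cases "i = 2")
      case True
      then show ?thesis by (simp add: j)
    next
      case False
      \<comment> \<open>For \<open>i \<ge> 3\<close> this gives
        \<open>2 * i + 1 \<le> i ^ 2\<close>, so the square at most doubles from \<open>i\<close> to
        \<open>i + 1\<close>. The factor 2 in the claim absorbs \<open>j = 3\<close>, where 9
        exceeds 8.\<close>
      with i have "3 * real i \<le> real i * real i" by (intro mult_right_mono) auto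
      moreover have "real i * real i \<le> 2 * 2 ^ i"
        using less[of i] j by (simp add: power2_eq_square)
      moreover have "1 \<le> real i" using i by simp
      moreover have "real j ^ 2 = real i * real i + 2 * real i + 1" "(2::real) ^ j = 2 * 2 ^ i"
        by (simp_all add: j power2_eq_square algebra_simps)
      ultimately show ?thesis by linarith
    qed
  qed
qed

text \<open>Since \<open>m\<close> is at least \<open>3 * n / 4\<close>, a bound \<open>C\<close>
  for \<open>m\<close> gives \<open>65 + C * (16 / 9) / 3\<close> for \<open>n\<close>. The factor
  16/27 is below 1, and \<open>C = 200\<close> closes the induction.\<close>

lemma deficit_bound: "deficit n * real n ^ 2 \<le> 200"
proof (induction n rule: less_induct)
  case (less n)
  show ?case
  \<comment> \<open>Below 4, \<open>n div 4\<close> is 0 and the recursion would not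
    descend.\<close>
  proof (cases "n < 4")
    case True
    then have "real n ^ 2 \<le> 3 ^ 2" by (intro power_mono) auto
    then show ?thesis
      using mult_mono[OF deficit_le_1[of n], of "real n ^ 2" "3 ^ 2"] by simp
  next
    case False
    define k where "k = n div 4"
    define m where "m = n - k"
    have n: "n = m + k" "m < n" "3 * n \<le> 4 * m" "n \<le> 4 * k + 3"
      using False unfolding m_def k_def by linarith+
    have "real n ^ 2 \<le> (4 * real k + 3) ^ 2"
      using n(4) by (intro power_mono) linarith+
    also have "\<dots> = 16 * real k ^ 2 + 24 * real k + 9"
      by (simp add: power2_eq_square algebra_simps)
    \<comment> \<open>The constant is \<open>16 * 2 + 24 + 9\<close>, from bounding
      \<open>k ^ 2\<close> by \<open>2 * 2 ^ k\<close> and both \<open>k\<close> and 1 by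
      \<open>2 ^ k\<close>.\<close>
    also have "\<dots> \<le> 65 * 2 ^ k"
      using square_le_pow2[of k] of_nat_less_two_power[of k, where 'a = real]
        one_le_power[of "2::real" k] by linarith
    finally have a: "1 / 2 ^ k * real n ^ 2 \<le> 65" by (simp add: field_simps)
    have "(3 * real n) ^ 2 \<le> (4 * real m) ^ 2"
      using n(3) by (intro power_mono) linarith+
    then have "deficit m * (9 * real n ^ 2) \<le> deficit m * (16 * real m ^ 2)"
      using deficit_nonneg[of m] by (intro mult_left_mono) (simp_all add: power_mult_distrib)
    with less[OF n(2)] have b: "deficit m * real n ^ 2 \<le> 3200 / 9" by simp
    have "deficit n * real n ^ 2 \<le> (1 / 2 ^ k + deficit m / 3) * real n ^ 2"
      using deficit_rec[of m k] n(1) by (intro mult_right_mono) auto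
    also have "\<dots> = 1 / 2 ^ k * real n ^ 2 + deficit m * real n ^ 2 / 3"
      by (simp add: algebra_simps)
    finally show ?thesis using a b by linarith
  qed
qed

lemma deficit_le: "0 < n \<Longrightarrow> deficit n \<le> 200 / real n ^ 2"
  using deficit_bound[of n] by (simp add: field_simps)

section \<open>Arbitrary prefixes\<close>

lemma b_seq_le: "b_seq n \<le> n"
  using lcs_length_le[of "pref thue_morse n"] by (simp add: b_seq_def pref_def)

text \<open>Each full block of length \<open>2 ^ m\<close> faces its complement and loses
  \<open>2 ^ m * deficit m\<close>; the incomplete last block is given up entirely.\<close>

lemma b_seq_ge: "real n - real (b_seq n) \<le> 2 ^ m + n * deficit m"
proof -
  define q where "q = n div 2 ^ m"
  define r where "r = n mod 2 ^ m"
  have n: "n = q * 2 ^ m + r" "r < 2 ^ m"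
    unfolding q_def r_def by (rule div_mult_mod_eq[symmetric], simp)
  have pre: "pref thue_morse n = pref thue_morse (q * 2 ^ m) @ map thue_morse [q * 2 ^ m..<n]"
    using upt_add_eq_append[of 0 "q * 2 ^ m" r] unfolding pref_def n(1)[symmetric] by simp
  have "q * a_seq m \<le> lcs_length (pref thue_morse (q * 2 ^ m)) (map Not (pref thue_morse (q * 2 ^ m)))"
    using lcs_length_concat[of "\<lambda>i. (mu ^^ m) [thue_morse i]" "\<lambda>i. (mu ^^ m) [\<not> thue_morse i]" q]
    unfolding thue_morse_blocks(2) unfolding thue_morse_blocks(1) lcs_length_blocks by simp
  also have "\<dots> \<le> b_seq n"
    unfolding b_seq_def pre map_append by (intro lcs_length_mono list_emb_prefix) simp_all
  finally have "real q * a_seq m \<le> b_seq n"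
    by (metis of_nat_le_iff of_nat_mult)
  moreover have "real q * a_seq m = real q * 2 ^ m - real q * 2 ^ m * deficit m"
    by (simp add: deficit_def field_simps)
  moreover have "real q * 2 ^ m * deficit m \<le> n * deficit m"
    using deficit_nonneg[of m] n(1) by (intro mult_right_mono) simp_all
  moreover have "real n = real q * 2 ^ m + r" "real r \<le> 2 ^ m"
    using n by (simp_all add: less_imp_le)
  ultimately show ?thesis by linarith
qed

lemma b_seq_bound:
  assumes "4 \<le> n"
  shows "1 - b_seq n / n \<le> 3232 / ln n ^ 2"
proof -
  \<comment> \<open>Blocks of length \<open>2 ^ m\<close> are then about \<open>sqrt n\<close> long:
    the tail is relatively negligible, while \<open>m\<close> still grows like
    \<open>ln n\<close>.\<close>
  obtain m where m: "4 ^ m \<le> n" "n < 4 ^ (m + 1)"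
    using ex_power_ivl1[of 4 n] assms by auto
  have m0: "0 < m" using assms m(2) by (cases m) auto
  have m': "(4::real) ^ m \<le> real n" "real n \<le> 4 ^ (m + 1)"
    using m by (metis of_nat_le_iff of_nat_numeral of_nat_power less_imp_le)+
  have pos: "real n > 0" using assms by simp
  have "ln (real n) \<le> ln (4 ^ (m + 1))" using m'(2) pos by simp
  also have "\<dots> = real (m + 1) * (2 * ln 2)"
    using ln_realpow[of 4 "m + 1"] ln_realpow[of 2 2] by simp
  \<comment> \<open>With \<open>m + 1 \<le> 2 * m\<close> this leads to
    \<open>ln n \<le> 4 * m\<close>, the source of the factor 16.\<close>
  also have "\<dots> \<le> real (m + 1) * (2 * 1)"
    using ln_2_less_1 by (intro mult_left_mono) simp_all
  also have "\<dots> \<le> 4 * real m" using m0 by simp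
  finally have "ln (real n) ^ 2 \<le> (4 * real m) ^ 2"
    using assms by (intro power_mono) simp_all
  moreover have "0 < ln (real n)" using assms by simp
  ultimately have l: "1 / real m ^ 2 \<le> 16 / ln (real n) ^ 2"
    using m0 by (simp add: field_simps)
  have "2 ^ m / real n \<le> 2 ^ m / 4 ^ m"
    using m' pos by (intro divide_left_mono) auto
  also have "\<dots> = 1 / 2 ^ m"
    by (simp add: field_simps flip: power_mult_distrib)
  also have "\<dots> \<le> 2 / real m ^ 2"
    using square_le_pow2[of m] m0 by (simp add: field_simps)
  finally have c: "2 ^ m / real n \<le> 2 / real m ^ 2" .
  have "1 - b_seq n / n = (real n - b_seq n) / n" using pos by (simp add: field_simps)
  also have "\<dots> \<le> (2 ^ m + n * deficit m) / n"
    using b_seq_ge[of n m] by (intro divide_right_mono) simp_all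
  also have "\<dots> = 2 ^ m / n + deficit m" using pos by (simp add: field_simps)
  \<comment> \<open>The tail contributes 2 and the blocks 200.\<close>
  also have "\<dots> \<le> 202 * (1 / real m ^ 2)" using c deficit_le[OF m0] by simp
  also have "\<dots> \<le> 202 * (16 / ln (real n) ^ 2)" using l by simp
  finally show ?thesis by simp
qed

section \<open>Asymptotics\<close>

text \<open>For \<open>g n \<ge> 1\<close> a larger exponent gives a smaller reciprocal. The
  threshold 4 also suits \<open>g n = ln n\<close>, as 4 exceeds \<open>exp 1\<close>.\<close>

lemma bigo_powr_weaken:
  fixes e g :: "nat \<Rightarrow> real"
  assumes "\<And>n. 4 \<le> n \<Longrightarrow> 0 \<le> e n" "\<And>n. 4 \<le> n \<Longrightarrow> e n \<le> C / g n ^ 2"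
    and "\<And>n. 4 \<le> n \<Longrightarrow> 1 \<le> g n" "0 \<le> C" "w \<le> 2"
  shows "e \<in> O(\<lambda>n. 1 / g n powr w)"
proof (rule bigoI[where c = C], rule eventually_sequentiallyI[where c = 4])
  fix n :: nat
  assume n: "4 \<le> n"
  have "g n powr w \<le> g n powr 2" using assms(3)[OF n] \<open>w \<le> 2\<close> by (rule powr_mono[rotated])
  also have "g n powr 2 = g n ^ 2" using assms(3)[OF n] by simp
  finally have "C / g n ^ 2 \<le> C / g n powr w"
    using assms(3)[OF n] \<open>0 \<le> C\<close> by (intro divide_left_mono) auto
  with assms(1,2)[OF n] show "norm (e n) \<le> C * norm (1 / g n powr w)" by simp
qed

theorem theorem5:
  fixes w :: real
  assumes "w = log 2 3"
  shows "(\<exists>e :: nat \<Rightarrow> real. e \<in> O(\<lambda>n. 1 / real n powr w) \<and>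
           (\<forall>\<^sub>F n in sequentially. real (a_seq n) = 2 ^ n * (1 - e n))) \<and>
         (\<exists>e :: nat \<Rightarrow> real. e \<in> O(\<lambda>n. 1 / ln (real n) powr w) \<and>
           (\<forall>\<^sub>F n in sequentially. real (b_seq n) = real n * (1 - e n)))"
proof -
  have "log 2 3 \<le> log 2 (2 ^ 2)" by (subst log_le_cancel_iff) simp_all
  also have "\<dots> = 2" by (subst log_nat_power) simp_all
  finally have w: "w \<le> 2" using assms by simp
  have "deficit \<in> O(\<lambda>n. 1 / real n powr w)"
    using w deficit_nonneg deficit_le by (intro bigo_powr_weaken[where C = 200]) simp_all
  moreover have "\<forall>\<^sub>F n in sequentially. real (a_seq n) = 2 ^ n * (1 - deficit n)"
    by (simp add: deficit_def)
  moreover have "(\<lambda>n. 1 - real (b_seq n) / real n) \<in> O(\<lambda>n. 1 / ln (real n) powr w)"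
  proof (rule bigo_powr_weaken[where C = 3232])
    fix n :: nat
    assume n: "4 \<le> n"
    show "0 \<le> 1 - real (b_seq n) / real n" using b_seq_le[of n] n by (simp add: field_simps)
    show "1 - real (b_seq n) / real n \<le> 3232 / ln (real n) ^ 2" using n by (rule b_seq_bound)
    show "1 \<le> ln (real n)"
      using n exp_le by (subst ln_ge_iff) auto
  qed (use w in simp_all)
  moreover have "\<forall>\<^sub>F n in sequentially. real (b_seq n) = real n * (1 - (1 - real (b_seq n) / real n))"
    by (rule eventually_sequentiallyI[where c = 1]) simp
  ultimately show ?thesis by blast
qed

end
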